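(* Let $\Gamma$ be a finite oriented simplicial complex on $n$ vertices, let $k\ge 1$, and let $G(S_k)$ be its $k$-simplex graph. Then: (a) For every $k$-simplex $\sigma\in S_k$, the $1$-norm of the $\sigma$ column of $H=I-\frac{1}{n}\Delta_k$ is $$\|H|\sigma\rangle\|_1 = 1+\frac{1}{n}\big(\deg(\sigma)-d_{\mathrm{up}}(\sigma)-k-1\big).$$ (b) The transition probabilities $P_{\sigma\tau}=\frac{|\langle\tau|H|\sigma\rangle|}{\|H|\sigma\rangle\|_1}$ are $$P_{\sigma\tau}=\begin{cases}\frac{1}{n+\deg(\sigma)-d_{\mathrm{up}}(\sigma)-k-1} & \sigma,\tau \text{ adjacent in } G(S_k),\\[2pt] \frac{n-d_{\mathrm{up}}(\sigma)-k-1}{n+\deg(\sigma)-d_{\mathrm{up}}(\sigma)-k-1} & \sigma=\tau,\\[2pt] 0 & \text{otherwise.}\end{cases}$$ (c) The maximum degree of a vertex of $G(S_k)$ is at most $(n-k-1)(k+1)$. If $\Gamma$ is the clique complex of a graph, then the maximum degree is at most $n-k-1$.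
   Context: A simplicial complex $\Gamma$ on vertex set $\{x_1,\dots,x_n\}$ is a family of subsets closed under taking subsets; its elements of size $k+1$ are $k$-simplices, and $S_k$ denotes the set of $k$-simplices. It is oriented via the order $x_1<\dots<x_n$. The boundary map $\partial_k:\mathbb{C}S_k\to\mathbb{C}S_{k-1}$ sends $|\{x_{i_0},\dots,x_{i_k}\}\rangle$ ($i_0<\dots<i_k$) to $\sum_{j=0}^k(-1)^{j+1}|\{x_{i_0},\dots,x_{i_k}\}\setminus\{x_{i_j}\}\rangle$. $\Delta_k$ is the matrix of $\partial_k^\dagger\partial_k+\partial_{k+1}\partial_{k+1}^\dagger$ in the basis $\{|\sigma\rangle:\sigma\in S_k\}$, and $H=I-\frac1n\Delta_k$. The up-degree $d_{\mathrm{up}}(\sigma)$ of $\sigma\in S_k$ is the number of $(k+1)$-simplices containing $\sigma$. The $k$-simplex graph $G(S_k)$ has vertex set $S_k$, with $\sigma\neq\tau$ adjacent iff $|\sigma\cap\tau|=k$ and $\sigma\cup\tau\notin\Gamma$; $\deg(\sigma)$ is the degree of $\sigma$ in this graph. $\|H|\sigma\rangle\|_1=\sum_{\tau\in S_k}|H_{\tau\sigma}|$. The clique complex of a graph $G$ is the simplicial complex whose simplices are the vertex sets of complete subgraphs of $G$. *)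

theory Defs
  imports Complex_Main "HOL-Library.Ramsey"
begin

text \<open>The vertices \<open>x\<^sub>1 < \<dots> < x\<^sub>n\<close> are the elements of a finite set in a linearly ordered type.
  Not every element of \<open>V\<close> has to be a \<open>0\<close>-simplex.\<close>

definition simplicial_complex :: "'a set \<Rightarrow> 'a set set \<Rightarrow> bool" where
  "simplicial_complex V \<Gamma> \<longleftrightarrow>
     finite V \<and> \<Gamma> \<subseteq> Pow V \<and> (\<forall>\<sigma>\<in>\<Gamma>. \<forall>\<tau>. \<tau> \<subseteq> \<sigma> \<longrightarrow> \<tau> \<in> \<Gamma>)"

definition simplices :: "'a set set \<Rightarrow> nat \<Rightarrow> 'a set set" where
  "simplices \<Gamma> k = {\<sigma> \<in> \<Gamma>. card \<sigma> = k + 1}"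

text \<open>A vector of \<open>\<complex>S\<^sub>k\<close> is given by its coordinates in the basis of \<open>k\<close>-simplices: it is a
  function that vanishes outside \<open>simplices \<Gamma> k\<close>.\<close>

type_synonym 'a chain = "'a set \<Rightarrow> complex"

definition ket :: "'a set \<Rightarrow> 'a chain" where
  "ket \<sigma> = (\<lambda>\<tau>. if \<tau> = \<sigma> then 1 else 0)"

definition inner_on :: "'a set set \<Rightarrow> 'a chain \<Rightarrow> 'a chain \<Rightarrow> complex" where
  "inner_on A f g = (\<Sum>\<sigma>\<in>A. cnj (f \<sigma>) * g \<sigma>)"

definition boundary_ket :: "nat \<Rightarrow> 'a::linorder set \<Rightarrow> 'a chain" where
  "boundary_ket k \<sigma> =
     (\<lambda>\<rho>. \<Sum>j=0..k. (-1) ^ (j + 1) * ket (\<sigma> - {sorted_list_of_set \<sigma> ! j}) \<rho>)"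

definition boundary :: "'a::linorder set set \<Rightarrow> nat \<Rightarrow> 'a chain \<Rightarrow> 'a chain" where
  "boundary \<Gamma> k f = (\<lambda>\<rho>. \<Sum>\<sigma>\<in>simplices \<Gamma> k. f \<sigma> * boundary_ket k \<sigma> \<rho>)"

text \<open>The adjoint of a linear map \<open>T : \<complex>A \<rightarrow> \<complex>B\<close>, for finite \<open>A\<close> and \<open>B\<close>, given by the conjugate
  transpose of its matrix; see \<open>adjoint_on_boundary\<close> below for its defining property.\<close>

definition adjoint_on ::
    "'a set set \<Rightarrow> 'a set set \<Rightarrow> ('a chain \<Rightarrow> 'a chain) \<Rightarrow> 'a chain \<Rightarrow> 'a chain" where
  "adjoint_on A B T g = (\<lambda>\<sigma>. if \<sigma> \<in> A then \<Sum>\<rho>\<in>B. cnj (T (ket \<sigma>) \<rho>) * g \<rho> else 0)"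

definition coboundary :: "'a::linorder set set \<Rightarrow> nat \<Rightarrow> 'a chain \<Rightarrow> 'a chain" where
  "coboundary \<Gamma> k = adjoint_on (simplices \<Gamma> k) (simplices \<Gamma> (k - 1)) (boundary \<Gamma> k)"

text \<open>Because of the truncated \<open>k - 1\<close>, \<open>coboundary\<close> and \<open>laplacian\<close> are only meant for
  \<open>k \<ge> 1\<close>.\<close>

definition laplacian :: "'a::linorder set set \<Rightarrow> nat \<Rightarrow> 'a chain \<Rightarrow> 'a chain" where
  "laplacian \<Gamma> k f =
     (\<lambda>\<tau>. coboundary \<Gamma> k (boundary \<Gamma> k f) \<tau> + boundary \<Gamma> (k + 1) (coboundary \<Gamma> (k + 1) f) \<tau>)"

text \<open>Matrices have the row index first: \<open>laplacian_mat \<Gamma> k \<tau> \<sigma>\<close> is \<open>\<langle>\<tau>|\<Delta>\<^sub>k|\<sigma>\<rangle>\<close>.\<close>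

definition laplacian_mat :: "'a::linorder set set \<Rightarrow> nat \<Rightarrow> 'a set \<Rightarrow> 'a set \<Rightarrow> complex" where
  "laplacian_mat \<Gamma> k \<tau> \<sigma> = laplacian \<Gamma> k (ket \<sigma>) \<tau>"

definition H_mat :: "nat \<Rightarrow> 'a::linorder set set \<Rightarrow> nat \<Rightarrow> 'a set \<Rightarrow> 'a set \<Rightarrow> complex" where
  "H_mat n \<Gamma> k \<tau> \<sigma> = (if \<tau> = \<sigma> then 1 else 0) - 1 / of_nat n * laplacian_mat \<Gamma> k \<tau> \<sigma>"

definition H_col_norm :: "nat \<Rightarrow> 'a::linorder set set \<Rightarrow> nat \<Rightarrow> 'a set \<Rightarrow> real" where
  "H_col_norm n \<Gamma> k \<sigma> = (\<Sum>\<tau>\<in>simplices \<Gamma> k. cmod (H_mat n \<Gamma> k \<tau> \<sigma>))"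

definition transition_prob ::
    "nat \<Rightarrow> 'a::linorder set set \<Rightarrow> nat \<Rightarrow> 'a set \<Rightarrow> 'a set \<Rightarrow> real" where
  "transition_prob n \<Gamma> k \<sigma> \<tau> = cmod (H_mat n \<Gamma> k \<tau> \<sigma>) / H_col_norm n \<Gamma> k \<sigma>"

definition up_degree :: "'a set set \<Rightarrow> nat \<Rightarrow> 'a set \<Rightarrow> nat" where
  "up_degree \<Gamma> k \<sigma> = card {\<rho> \<in> simplices \<Gamma> (k + 1). \<sigma> \<subseteq> \<rho>}"

definition simplex_adj :: "'a set set \<Rightarrow> nat \<Rightarrow> 'a set \<Rightarrow> 'a set \<Rightarrow> bool" where
  "simplex_adj \<Gamma> k \<sigma> \<tau> \<longleftrightarrow>
     \<sigma> \<in> simplices \<Gamma> k \<and> \<tau> \<in> simplices \<Gamma> k \<and> \<sigma> \<noteq> \<tau> \<and> card (\<sigma> \<inter> \<tau>) = k \<and> \<sigma> \<union> \<tau> \<notin> \<Gamma>"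

definition simplex_degree :: "'a set set \<Rightarrow> nat \<Rightarrow> 'a set \<Rightarrow> nat" where
  "simplex_degree \<Gamma> k \<sigma> = card {\<tau> \<in> simplices \<Gamma> k. simplex_adj \<Gamma> k \<sigma> \<tau>}"

definition max_simplex_degree :: "'a set set \<Rightarrow> nat \<Rightarrow> nat" where
  "max_simplex_degree \<Gamma> k = Max (simplex_degree \<Gamma> k ` simplices \<Gamma> k)"

definition simple_graph :: "'a set \<Rightarrow> 'a set set \<Rightarrow> bool" where
  "simple_graph W E \<longleftrightarrow> E \<subseteq> [W]\<^bsup>2\<^esup>"

definition clique_complex :: "'a set \<Rightarrow> 'a set set \<Rightarrow> 'a set set" where
  "clique_complex W E = {C. C \<subseteq> W \<and> clique C E}"

lemma boundary_ket_basis: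
  assumes "finite (simplices \<Gamma> k)" and "\<sigma> \<in> simplices \<Gamma> k"
  shows "boundary \<Gamma> k (ket \<sigma>) = boundary_ket k \<sigma>"
proof
  fix \<rho>
  have "boundary \<Gamma> k (ket \<sigma>) \<rho> =
      (\<Sum>\<tau>\<in>simplices \<Gamma> k. if \<tau> = \<sigma> then boundary_ket k \<tau> \<rho> else 0)"
    unfolding boundary_def ket_def by (intro sum.cong) auto
  then show "boundary \<Gamma> k (ket \<sigma>) \<rho> = boundary_ket k \<sigma> \<rho>"
    using assms by simp
qed

lemma adjoint_on_boundary:
  assumes "finite (simplices \<Gamma> k)"
  shows "inner_on B (boundary \<Gamma> k f) g =
    inner_on (simplices \<Gamma> k) f (adjoint_on (simplices \<Gamma> k) B (boundary \<Gamma> k) g)"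
proof -
  have "inner_on B (boundary \<Gamma> k f) g =
      (\<Sum>\<rho>\<in>B. \<Sum>\<sigma>\<in>simplices \<Gamma> k. cnj (f \<sigma>) * (cnj (boundary_ket k \<sigma> \<rho>) * g \<rho>))"
    by (simp add: inner_on_def boundary_def sum_distrib_right mult.assoc)
  also have "\<dots> =
      (\<Sum>\<sigma>\<in>simplices \<Gamma> k. \<Sum>\<rho>\<in>B. cnj (f \<sigma>) * (cnj (boundary_ket k \<sigma> \<rho>) * g \<rho>))"
    by (rule sum.swap)
  also have "\<dots> =
      inner_on (simplices \<Gamma> k) f (adjoint_on (simplices \<Gamma> k) B (boundary \<Gamma> k) g)"
    unfolding inner_on_def adjoint_on_def
    by (intro sum.cong) (simp_all add: boundary_ket_basis[OF assms] sum_distrib_left)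
  finally show ?thesis .
qed

end

theory Submission
  imports Defs
begin

text \<open>Distinct \<open>k\<close>-simplices \<open>\<sigma>\<close>, \<open>\<tau>\<close> have at most one common facet, namely \<open>\<sigma> \<inter> \<tau>\<close>, and at most
  one common cofacet, namely \<open>\<sigma> \<union> \<tau>\<close>. The paths from \<open>\<sigma>\<close> to \<open>\<tau>\<close> through these two sets carry opposite
  signs, so the contributions of \<open>\<partial>\<^sub>k\<^sup>\<dagger>\<partial>\<^sub>k\<close> and \<open>\<partial>\<^sub>k\<^sub>+\<^sub>1\<partial>\<^sub>k\<^sub>+\<^sub>1\<^sup>\<dagger>\<close> cancel if \<open>\<sigma> \<union> \<tau> \<in> \<Gamma>\<close>. Hence the
  off-diagonal entries of \<open>\<Delta>\<^sub>k\<close> are \<open>\<plusminus>1\<close> on edges of the simplex graph and \<open>0\<close> elsewhere, while the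
  diagonal entries are \<open>k + 1 + d\<^sub>u\<^sub>p(\<sigma>) \<le> n\<close>. A neighbour of \<open>\<sigma>\<close> arises by exchanging some \<open>u \<in> \<sigma>\<close>
  for some \<open>v \<in> V - \<sigma>\<close>; in a clique complex \<open>v\<close> determines \<open>u\<close>, the only vertex of \<open>\<sigma>\<close> not joined to
  \<open>v\<close>.\<close>

subsection \<open>Facets\<close>

definition facets :: "'a set \<Rightarrow> 'a set set" where
  "facets \<sigma> = (\<lambda>x. \<sigma> - {x}) ` \<sigma>"

lemma mem_facets_iff_insert: "\<rho> \<in> facets \<sigma> \<longleftrightarrow> (\<exists>x. x \<notin> \<rho> \<and> \<sigma> = insert x \<rho>)"
proof
  assume "\<rho> \<in> facets \<sigma>"
  then show "\<exists>x. x \<notin> \<rho> \<and> \<sigma> = insert x \<rho>"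
    by (auto simp: facets_def)
next
  assume "\<exists>x. x \<notin> \<rho> \<and> \<sigma> = insert x \<rho>"
  then obtain x where "x \<in> \<sigma>" and "\<rho> = \<sigma> - {x}" by blast
  then show "\<rho> \<in> facets \<sigma>" by (simp add: facets_def)
qed

lemma facetsE:
  assumes "\<rho> \<in> facets \<sigma>"
  obtains x where "x \<notin> \<rho>" and "\<sigma> = insert x \<rho>"
  using assms by (auto simp: mem_facets_iff_insert)

lemma mem_facets_iff_Diff: "\<rho> \<in> facets \<sigma> \<longleftrightarrow> \<rho> \<subseteq> \<sigma> \<and> (\<exists>x. \<sigma> - \<rho> = {x})"
  unfolding mem_facets_iff_insert by blast

lemma mem_facets_iff_card:
  assumes "finite \<sigma>"
  shows "\<rho> \<in> facets \<sigma> \<longleftrightarrow> \<rho> \<subseteq> \<sigma> \<and> card \<sigma> = Suc (card \<rho>)"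
proof -
  have "card (\<sigma> - \<rho>) = 1 \<longleftrightarrow> card \<sigma> = Suc (card \<rho>)" if "\<rho> \<subseteq> \<sigma>"
    using card_Diff_subset[OF finite_subset[OF that assms] that] card_mono[OF assms that] by auto
  then show ?thesis
    by (auto simp: mem_facets_iff_Diff card_1_singleton_iff)
qed

lemma card_facets: "card (facets \<sigma>) = card \<sigma>"
  unfolding facets_def by (intro card_image inj_onI) blast

lemma common_facet_eq_Int:
  assumes "\<rho> \<in> facets \<sigma>" and "\<rho> \<in> facets \<tau>" and "\<sigma> \<noteq> \<tau>"
  shows "\<rho> = \<sigma> \<inter> \<tau>"
  using assms by (auto elim!: facetsE)

lemma common_cofacet_eq_Un:
  assumes "\<sigma> \<in> facets \<omega>" and "\<tau> \<in> facets \<omega>" and "\<sigma> \<noteq> \<tau>"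
  shows "\<omega> = \<sigma> \<union> \<tau>"
  using assms by (auto simp: facets_def)

lemma Int_mem_facets_iff: "\<sigma> \<inter> \<tau> \<in> facets \<sigma> \<longleftrightarrow> (\<exists>u. \<sigma> - \<tau> = {u})"
  by (auto simp: mem_facets_iff_Diff)

lemma mem_facets_Un_iff: "\<tau> \<in> facets (\<sigma> \<union> \<tau>) \<longleftrightarrow> (\<exists>u. \<sigma> - \<tau> = {u})"
  by (auto simp: mem_facets_iff_Diff Un_Diff)

subsection \<open>Incidence numbers\<close>

definition vertex_sign :: "'a::linorder set \<Rightarrow> 'a \<Rightarrow> complex" where
  "vertex_sign \<rho> x = (-1) ^ (card {y \<in> \<rho>. y < x} + 1)"

definition incidence :: "'a::linorder set \<Rightarrow> 'a set \<Rightarrow> complex" where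
  "incidence \<sigma> \<rho> = (if \<rho> \<in> facets \<sigma> then vertex_sign \<rho> (the_elem (\<sigma> - \<rho>)) else 0)"

lemma vertex_sign_insert:
  assumes "finite \<rho>" and "u \<notin> \<rho>"
  shows "vertex_sign (insert u \<rho>) v = (if u < v then - vertex_sign \<rho> v else vertex_sign \<rho> v)"
proof -
  have "{y \<in> insert u \<rho>. y < v} = (if u < v then insert u {y \<in> \<rho>. y < v} else {y \<in> \<rho>. y < v})"
    by auto
  then show ?thesis
    using assms by (simp add: vertex_sign_def)
qed

lemma incidence_eq_0_iff [simp]: "incidence \<sigma> \<rho> = 0 \<longleftrightarrow> \<rho> \<notin> facets \<sigma>"
  by (simp add: incidence_def vertex_sign_def)

lemma cnj_incidence [simp]: "cnj (incidence \<sigma> \<rho>) = incidence \<sigma> \<rho>"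
  by (simp add: incidence_def vertex_sign_def)

lemma cmod_incidence: "cmod (incidence \<sigma> \<rho>) = (if \<rho> \<in> facets \<sigma> then 1 else 0)"
  by (simp add: incidence_def vertex_sign_def norm_power)

lemma incidence_mult_self: "incidence \<sigma> \<rho> * incidence \<sigma> \<rho> = (if \<rho> \<in> facets \<sigma> then 1 else 0)"
  by (simp add: incidence_def vertex_sign_def flip: power_mult_distrib)

lemma incidence_diamond:
  assumes "finite (\<sigma> \<inter> \<tau>)"
  shows "incidence (\<sigma> \<union> \<tau>) \<sigma> * incidence (\<sigma> \<union> \<tau>) \<tau> = - (incidence \<tau> (\<sigma> \<inter> \<tau>) * incidence \<sigma> (\<sigma> \<inter> \<tau>))"
proof (cases "(\<exists>u. \<sigma> - \<tau> = {u}) \<and> (\<exists>v. \<tau> - \<sigma> = {v})")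
  case True
  then obtain u v where u: "\<sigma> - \<tau> = {u}" and v: "\<tau> - \<sigma> = {v}" by blast
  let ?\<rho> = "\<sigma> \<inter> \<tau>"
  have ins: "\<sigma> = insert u ?\<rho>" "\<tau> = insert v ?\<rho>" and "u \<notin> ?\<rho>" "v \<notin> ?\<rho>" "u \<noteq> v"
    using u v by blast+
  have "incidence \<sigma> ?\<rho> = vertex_sign ?\<rho> u" "incidence (\<sigma> \<union> \<tau>) \<tau> = vertex_sign \<tau> u"
    using u Int_mem_facets_iff[of \<sigma> \<tau>] mem_facets_Un_iff[of \<tau> \<sigma>]
    by (simp_all add: incidence_def Diff_Int Un_Diff)
  moreover have "incidence \<tau> ?\<rho> = vertex_sign ?\<rho> v" "incidence (\<sigma> \<union> \<tau>) \<sigma> = vertex_sign \<sigma> v"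
    using v Int_mem_facets_iff[of \<tau> \<sigma>] mem_facets_Un_iff[of \<sigma> \<tau>]
    by (simp_all add: incidence_def Diff_Int Un_Diff Int_commute Un_commute)
  moreover have "vertex_sign \<sigma> v * vertex_sign \<tau> u = - (vertex_sign ?\<rho> v * vertex_sign ?\<rho> u)"
    using vertex_sign_insert[OF assms \<open>u \<notin> ?\<rho>\<close>, of v] vertex_sign_insert[OF assms \<open>v \<notin> ?\<rho>\<close>, of u]
      \<open>u \<noteq> v\<close> by (cases "u < v") (auto simp flip: ins)
  ultimately show ?thesis by simp
next
  case False
  then have "incidence (\<sigma> \<union> \<tau>) \<sigma> * incidence (\<sigma> \<union> \<tau>) \<tau> = 0"
    using mem_facets_Un_iff[of \<tau> \<sigma>] mem_facets_Un_iff[of \<sigma> \<tau>] by (auto simp: Un_commute)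
  moreover have "incidence \<tau> (\<sigma> \<inter> \<tau>) * incidence \<sigma> (\<sigma> \<inter> \<tau>) = 0"
    using False Int_mem_facets_iff[of \<tau> \<sigma>] Int_mem_facets_iff[of \<sigma> \<tau>] by (auto simp: Int_commute)
  ultimately show ?thesis by (simp only: minus_zero)
qed

lemma set_take_eq_less_nth:
  fixes xs :: "'a::linorder list"
  assumes "sorted_wrt (<) xs" and "j < length xs"
  shows "set (take j xs) = {y \<in> set xs. y < xs ! j}"
  using assms
proof (induction xs arbitrary: j)
  case (Cons x xs)
  show ?case
  proof (cases j)
    case 0
    then show ?thesis
      using Cons.prems by auto
  next
    case (Suc i)
    then have "x < xs ! i" and "set (take i xs) = {y \<in> set xs. y < xs ! i}"
      using Cons by simp_all
    then show ?thesis
      using Suc by auto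
  qed
qed simp

lemma card_less_nth_sorted_list_of_set:
  fixes \<sigma> :: "'a::linorder set"
  assumes "finite \<sigma>" and "j < card \<sigma>"
  shows "card {y \<in> \<sigma>. y < sorted_list_of_set \<sigma> ! j} = j"
  using set_take_eq_less_nth[of "sorted_list_of_set \<sigma>" j, symmetric] assms
  by (simp add: distinct_card)

lemma incidence_eq_sum_ket:
  assumes "finite \<sigma>"
  shows "incidence \<sigma> \<rho> = (\<Sum>x\<in>\<sigma>. vertex_sign \<sigma> x * ket (\<sigma> - {x}) \<rho>)"
proof (cases "\<rho> \<in> facets \<sigma>")
  case True
  then obtain x where x: "x \<notin> \<rho>" "\<sigma> = insert x \<rho>" by (rule facetsE)
  have "incidence \<sigma> \<rho> = vertex_sign \<rho> x"
    using True x by (simp add: incidence_def insert_Diff_if)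
  also have "\<dots> = vertex_sign \<sigma> x"
    using vertex_sign_insert[of \<rho> x x] assms x by simp
  also have "\<dots> = (\<Sum>y\<in>\<sigma>. if y = x then vertex_sign \<sigma> y else 0)"
    using assms x by simp
  also have "\<dots> = (\<Sum>y\<in>\<sigma>. vertex_sign \<sigma> y * ket (\<sigma> - {y}) \<rho>)"
    using x by (intro sum.cong) (auto simp: ket_def)
  finally show ?thesis .
next
  case False
  then have "(\<Sum>x\<in>\<sigma>. vertex_sign \<sigma> x * ket (\<sigma> - {x}) \<rho>) = 0"
    by (intro sum.neutral) (auto simp: facets_def ket_def)
  with False show ?thesis by simp
qed

lemma boundary_ket_eq_incidence:
  assumes "finite \<sigma>" and "card \<sigma> = k + 1"
  shows "boundary_ket k \<sigma> \<rho> = incidence \<sigma> \<rho>"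
proof -
  let ?xs = "sorted_list_of_set \<sigma>"
  have bij: "bij_betw ((!) ?xs) {0..k} \<sigma>"
    by (rule bij_betw_nth) (use assms in auto)
  have "boundary_ket k \<sigma> \<rho> = (\<Sum>j\<in>{0..k}. vertex_sign \<sigma> (?xs ! j) * ket (\<sigma> - {?xs ! j}) \<rho>)"
    unfolding boundary_ket_def vertex_sign_def
    using assms by (intro sum.cong) (simp_all add: card_less_nth_sorted_list_of_set)
  also have "\<dots> = (\<Sum>x\<in>\<sigma>. vertex_sign \<sigma> x * ket (\<sigma> - {x}) \<rho>)"
    by (rule sum.reindex_bij_betw[OF bij])
  finally show ?thesis
    using incidence_eq_sum_ket[OF assms(1)] by simp
qed

subsection \<open>The Laplacian of a simplicial complex\<close>

locale finite_simplicial_complex =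
  fixes V :: "'a::linorder set" and \<Gamma> :: "'a set set"
  assumes simplicial_complex: "simplicial_complex V \<Gamma>"
begin

lemma finite_vertices: "finite V"
  using simplicial_complex by (simp add: simplicial_complex_def)

lemma face_in_complex: "\<sigma> \<in> \<Gamma> \<Longrightarrow> \<tau> \<subseteq> \<sigma> \<Longrightarrow> \<tau> \<in> \<Gamma>"
  using simplicial_complex unfolding simplicial_complex_def by blast

lemma finite_simplices: "finite (simplices \<Gamma> k)"
  using simplicial_complex unfolding simplicial_complex_def simplices_def
  by (auto intro: finite_subset[of _ "Pow V"])

lemma simplicesD:
  assumes "\<sigma> \<in> simplices \<Gamma> k"
  shows "finite \<sigma>" and "card \<sigma> = k + 1" and "\<sigma> \<subseteq> V" and "\<sigma> \<in> \<Gamma>"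
  using assms simplicial_complex unfolding simplicial_complex_def simplices_def
  by (auto intro: finite_subset)

lemma card_vertices_Diff:
  assumes "\<sigma> \<in> simplices \<Gamma> k"
  shows "card (V - \<sigma>) + k + 1 = card V"
  using simplicesD[OF assms] card_mono[OF finite_vertices, of \<sigma>] by (simp add: card_Diff_subset)

lemma facet_in_simplices:
  assumes "\<sigma> \<in> simplices \<Gamma> k" and "k \<ge> 1" and "\<rho> \<in> facets \<sigma>"
  shows "\<rho> \<in> simplices \<Gamma> (k - 1)"
  using assms simplicesD[OF assms(1)] face_in_complex[of \<sigma> \<rho>]
  by (auto simp: simplices_def mem_facets_iff_card)

lemma cofacet_in_simplices:
  assumes "\<sigma> \<in> simplices \<Gamma> k" and "\<omega> \<in> \<Gamma>" and "\<sigma> \<in> facets \<omega>"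
  shows "\<omega> \<in> simplices \<Gamma> (k + 1)"
  using assms simplicesD(1,2)[OF assms(1)] by (auto simp: simplices_def elim: facetsE)

lemma up_degree_eq_card_cofacets:
  assumes "\<sigma> \<in> simplices \<Gamma> k"
  shows "up_degree \<Gamma> k \<sigma> = card {\<omega> \<in> simplices \<Gamma> (k + 1). \<sigma> \<in> facets \<omega>}"
proof -
  have "\<sigma> \<subseteq> \<omega> \<longleftrightarrow> \<sigma> \<in> facets \<omega>" if "\<omega> \<in> simplices \<Gamma> (k + 1)" for \<omega>
    using simplicesD[OF assms] simplicesD[OF that] by (simp add: mem_facets_iff_card)
  then show ?thesis
    unfolding up_degree_def by (intro arg_cong[of _ _ card]) auto
qed

lemma laplacian_mat_eq_sum_incidence:
  assumes "\<sigma> \<in> simplices \<Gamma> k" and "\<tau> \<in> simplices \<Gamma> k"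
  shows "laplacian_mat \<Gamma> k \<tau> \<sigma> =
    (\<Sum>\<rho>\<in>simplices \<Gamma> (k - 1). incidence \<tau> \<rho> * incidence \<sigma> \<rho>) +
    (\<Sum>\<omega>\<in>simplices \<Gamma> (k + 1). incidence \<omega> \<sigma> * incidence \<omega> \<tau>)"
proof -
  have boundary: "boundary \<Gamma> m (ket \<omega>) = incidence \<omega>" if "\<omega> \<in> simplices \<Gamma> m" for m \<omega>
    using boundary_ket_basis[OF finite_simplices that]
      boundary_ket_eq_incidence[OF simplicesD(1,2)[OF that]] by auto
  have down: "coboundary \<Gamma> k (boundary \<Gamma> k (ket \<sigma>)) \<tau> =
      (\<Sum>\<rho>\<in>simplices \<Gamma> (k - 1). incidence \<tau> \<rho> * incidence \<sigma> \<rho>)"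
    using assms by (simp add: coboundary_def adjoint_on_def boundary)
  have "coboundary \<Gamma> (k + 1) (ket \<sigma>) \<omega> = incidence \<omega> \<sigma>" if "\<omega> \<in> simplices \<Gamma> (k + 1)" for \<omega>
  proof -
    have "coboundary \<Gamma> (k + 1) (ket \<sigma>) \<omega> = (\<Sum>\<rho>\<in>simplices \<Gamma> k. incidence \<omega> \<rho> * ket \<sigma> \<rho>)"
      using that by (simp add: coboundary_def adjoint_on_def boundary)
    then show ?thesis
      using assms(1) by (simp add: ket_def if_distrib[of "(*) _"] finite_simplices cong: if_cong)
  qed
  then have "boundary \<Gamma> (k + 1) (coboundary \<Gamma> (k + 1) (ket \<sigma>)) \<tau> =
      (\<Sum>\<omega>\<in>simplices \<Gamma> (k + 1). incidence \<omega> \<sigma> * incidence \<omega> \<tau>)"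
    unfolding boundary_def
    by (intro sum.cong) (simp_all add: boundary_ket_eq_incidence simplicesD)
  with down show ?thesis
    by (simp add: laplacian_mat_def laplacian_def)
qed

lemma laplacian_mat_diag:
  assumes "\<sigma> \<in> simplices \<Gamma> k" and "k \<ge> 1"
  shows "laplacian_mat \<Gamma> k \<sigma> \<sigma> = of_nat (k + 1 + up_degree \<Gamma> k \<sigma>)"
proof -
  have "(\<Sum>\<rho>\<in>simplices \<Gamma> (k - 1). incidence \<sigma> \<rho> * incidence \<sigma> \<rho>) =
      of_nat (card (simplices \<Gamma> (k - 1) \<inter> facets \<sigma>))"
    by (simp add: incidence_mult_self finite_simplices sum.If_cases)
  moreover have "simplices \<Gamma> (k - 1) \<inter> facets \<sigma> = facets \<sigma>"
    using facet_in_simplices[OF assms] by blast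
  moreover have "(\<Sum>\<omega>\<in>simplices \<Gamma> (k + 1). incidence \<omega> \<sigma> * incidence \<omega> \<sigma>) =
      of_nat (up_degree \<Gamma> k \<sigma>)"
    by (simp add: incidence_mult_self finite_simplices sum.If_cases Int_def
        up_degree_eq_card_cofacets[OF assms(1)])
  ultimately show ?thesis
    using laplacian_mat_eq_sum_incidence[OF assms(1,1)] simplicesD(2)[OF assms(1)]
    by (simp add: card_facets)
qed

lemma sum_common_facets:
  assumes "\<sigma> \<in> simplices \<Gamma> k" and "k \<ge> 1" and "\<sigma> \<noteq> \<tau>"
  shows "(\<Sum>\<rho>\<in>simplices \<Gamma> (k - 1). incidence \<tau> \<rho> * incidence \<sigma> \<rho>) =
    incidence \<tau> (\<sigma> \<inter> \<tau>) * incidence \<sigma> (\<sigma> \<inter> \<tau>)"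
proof -
  have "(\<Sum>\<rho>\<in>simplices \<Gamma> (k - 1). incidence \<tau> \<rho> * incidence \<sigma> \<rho>) =
      (\<Sum>\<rho>\<in>simplices \<Gamma> (k - 1).
        if \<rho> = \<sigma> \<inter> \<tau> then incidence \<tau> (\<sigma> \<inter> \<tau>) * incidence \<sigma> (\<sigma> \<inter> \<tau>) else 0)"
    using common_facet_eq_Int[OF _ _ assms(3)] by (intro sum.cong) auto
  moreover have "incidence \<sigma> (\<sigma> \<inter> \<tau>) = 0" if "\<sigma> \<inter> \<tau> \<notin> simplices \<Gamma> (k - 1)"
    using facet_in_simplices[OF assms(1,2)] that by auto
  ultimately show ?thesis
    by (simp add: finite_simplices)
qed

lemma sum_common_cofacets:
  assumes "\<sigma> \<in> simplices \<Gamma> k" and "\<sigma> \<noteq> \<tau>"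
  shows "(\<Sum>\<omega>\<in>simplices \<Gamma> (k + 1). incidence \<omega> \<sigma> * incidence \<omega> \<tau>) =
    (if \<sigma> \<union> \<tau> \<in> \<Gamma> then incidence (\<sigma> \<union> \<tau>) \<sigma> * incidence (\<sigma> \<union> \<tau>) \<tau> else 0)"
proof -
  have "(\<Sum>\<omega>\<in>simplices \<Gamma> (k + 1). incidence \<omega> \<sigma> * incidence \<omega> \<tau>) =
      (\<Sum>\<omega>\<in>simplices \<Gamma> (k + 1).
        if \<omega> = \<sigma> \<union> \<tau> then incidence (\<sigma> \<union> \<tau>) \<sigma> * incidence (\<sigma> \<union> \<tau>) \<tau> else 0)"
    using common_cofacet_eq_Un[OF _ _ assms(2)] by (intro sum.cong) auto
  moreover have "incidence (\<sigma> \<union> \<tau>) \<sigma> = 0" if "\<sigma> \<union> \<tau> \<in> \<Gamma>" "\<sigma> \<union> \<tau> \<notin> simplices \<Gamma> (k + 1)"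
    using cofacet_in_simplices[OF assms(1)] that by auto
  moreover have "\<sigma> \<union> \<tau> \<notin> simplices \<Gamma> (k + 1)" if "\<sigma> \<union> \<tau> \<notin> \<Gamma>"
    using simplicesD(4) that by blast
  ultimately show ?thesis
    by (simp add: finite_simplices)
qed

lemma laplacian_mat_off_diag:
  assumes "\<sigma> \<in> simplices \<Gamma> k" and "\<tau> \<in> simplices \<Gamma> k" and "k \<ge> 1" and "\<sigma> \<noteq> \<tau>"
  shows "laplacian_mat \<Gamma> k \<tau> \<sigma> =
    (if \<sigma> \<union> \<tau> \<in> \<Gamma> then 0 else incidence \<tau> (\<sigma> \<inter> \<tau>) * incidence \<sigma> (\<sigma> \<inter> \<tau>))"
  unfolding laplacian_mat_eq_sum_incidence[OF assms(1,2)] sum_common_facets[OF assms(1,3,4)]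
    sum_common_cofacets[OF assms(1,4)]
  using incidence_diamond[of \<sigma> \<tau>] simplicesD(1)[OF assms(1)] by simp

lemma simplex_adj_iff_facets:
  assumes "\<sigma> \<in> simplices \<Gamma> k" and "\<tau> \<in> simplices \<Gamma> k"
  shows "simplex_adj \<Gamma> k \<sigma> \<tau> \<longleftrightarrow> \<sigma> \<inter> \<tau> \<in> facets \<sigma> \<and> \<sigma> \<inter> \<tau> \<in> facets \<tau> \<and> \<sigma> \<union> \<tau> \<notin> \<Gamma>"
proof -
  note \<sigma> = simplicesD[OF assms(1)] and \<tau> = simplicesD[OF assms(2)]
  have "\<sigma> \<inter> \<tau> \<in> facets \<sigma> \<longleftrightarrow> card (\<sigma> \<inter> \<tau>) = k" and "\<sigma> \<inter> \<tau> \<in> facets \<tau> \<longleftrightarrow> card (\<sigma> \<inter> \<tau>) = k"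
    using mem_facets_iff_card[OF \<sigma>(1)] mem_facets_iff_card[OF \<tau>(1)] \<sigma>(2) \<tau>(2) by auto
  moreover have "\<sigma> \<noteq> \<tau>" if "card (\<sigma> \<inter> \<tau>) = k"
    using \<sigma>(2) that by auto
  ultimately show ?thesis
    using assms by (auto simp: simplex_adj_def)
qed

lemma cmod_laplacian_mat_off_diag:
  assumes "\<sigma> \<in> simplices \<Gamma> k" and "\<tau> \<in> simplices \<Gamma> k" and "k \<ge> 1" and "\<sigma> \<noteq> \<tau>"
  shows "cmod (laplacian_mat \<Gamma> k \<tau> \<sigma>) = (if simplex_adj \<Gamma> k \<sigma> \<tau> then 1 else 0)"
  using laplacian_mat_off_diag[OF assms] simplex_adj_iff_facets[OF assms(1,2)]
  by (simp add: norm_mult cmod_incidence)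

subsection \<open>The columns of \<open>H\<close>\<close>

lemma up_degree_le_card_vertices:
  assumes "\<sigma> \<in> simplices \<Gamma> k"
  shows "up_degree \<Gamma> k \<sigma> + k + 1 \<le> card V"
proof -
  have "{\<omega> \<in> simplices \<Gamma> (k + 1). \<sigma> \<in> facets \<omega>} \<subseteq> (\<lambda>x. insert x \<sigma>) ` (V - \<sigma>)"
    using simplicesD(3) by (fastforce elim!: facetsE)
  then have "up_degree \<Gamma> k \<sigma> \<le> card (V - \<sigma>)"
    unfolding up_degree_eq_card_cofacets[OF assms] using finite_vertices
    by (meson surj_card_le finite_Diff)
  then show ?thesis
    using card_vertices_Diff[OF assms] by simp
qed

lemma cmod_H_mat:
  assumes "\<sigma> \<in> simplices \<Gamma> k" and "\<tau> \<in> simplices \<Gamma> k" and "k \<ge> 1"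
    and "up_degree \<Gamma> k \<sigma> + k + 1 \<le> n"
  shows "cmod (H_mat n \<Gamma> k \<tau> \<sigma>) =
    (if \<tau> = \<sigma> then (real n - real (up_degree \<Gamma> k \<sigma>) - real k - 1) / real n
     else if simplex_adj \<Gamma> k \<sigma> \<tau> then 1 / real n else 0)"
proof (cases "\<tau> = \<sigma>")
  case True
  have "H_mat n \<Gamma> k \<sigma> \<sigma> =
      complex_of_real ((real n - real (up_degree \<Gamma> k \<sigma>) - real k - 1) / real n)"
    using assms(4) by (simp add: H_mat_def laplacian_mat_diag[OF assms(1,3)] field_simps)
  moreover have "real n - real (up_degree \<Gamma> k \<sigma>) - real k - 1 \<ge> 0"
    using assms(4) by linarith
  ultimately show ?thesis
    using True by (simp del: of_real_divide of_real_diff)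
next
  case False
  then show ?thesis
    using cmod_laplacian_mat_off_diag[OF assms(1-3)]
    by (auto simp: H_mat_def norm_mult norm_divide)
qed

lemma H_col_norm_eq:
  assumes "\<sigma> \<in> simplices \<Gamma> k" and "k \<ge> 1" and "up_degree \<Gamma> k \<sigma> + k + 1 \<le> n"
  shows "H_col_norm n \<Gamma> k \<sigma> =
    (real n + real (simplex_degree \<Gamma> k \<sigma>) - real (up_degree \<Gamma> k \<sigma>) - real k - 1) / real n"
proof -
  let ?S = "simplices \<Gamma> k"
  note cmod_H = cmod_H_mat[OF assms(1) _ assms(2,3)]
  have "(\<Sum>\<tau>\<in>?S - {\<sigma>}. cmod (H_mat n \<Gamma> k \<tau> \<sigma>)) =
      (\<Sum>\<tau>\<in>{\<tau> \<in> ?S. simplex_adj \<Gamma> k \<sigma> \<tau>}. 1 / real n)"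
    by (rule sum.mono_neutral_cong_right)
      (use cmod_H finite_simplices in \<open>auto simp: simplex_adj_def\<close>)
  then have "H_col_norm n \<Gamma> k \<sigma> = (real n - real (up_degree \<Gamma> k \<sigma>) - real k - 1) / real n +
      real (simplex_degree \<Gamma> k \<sigma>) / real n"
    unfolding H_col_norm_def sum.remove[OF finite_simplices assms(1)]
    using cmod_H[OF assms(1)] by (simp add: simplex_degree_def)
  then show ?thesis
    by (simp flip: add_divide_distrib)
qed

lemma transition_prob_eq:
  assumes "\<sigma> \<in> simplices \<Gamma> k" and "\<tau> \<in> simplices \<Gamma> k" and "k \<ge> 1"
    and "up_degree \<Gamma> k \<sigma> + k + 1 \<le> n"
  shows "transition_prob n \<Gamma> k \<sigma> \<tau> =
    (if simplex_adj \<Gamma> k \<sigma> \<tau> then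
       1 / (real n + real (simplex_degree \<Gamma> k \<sigma>) - real (up_degree \<Gamma> k \<sigma>) - real k - 1)
     else if \<sigma> = \<tau> then
       (real n - real (up_degree \<Gamma> k \<sigma>) - real k - 1) /
       (real n + real (simplex_degree \<Gamma> k \<sigma>) - real (up_degree \<Gamma> k \<sigma>) - real k - 1)
     else 0)"
proof -
  have "\<sigma> \<noteq> \<tau>" if "simplex_adj \<Gamma> k \<sigma> \<tau>"
    using that by (simp add: simplex_adj_def)
  moreover have "real n > 0"
    using assms(4) by simp
  ultimately show ?thesis
    unfolding transition_prob_def cmod_H_mat[OF assms] H_col_norm_eq[OF assms(1,3,4)] by auto
qed

subsection \<open>Degrees in the simplex graph\<close>

lemma simplex_adj_exchange:
  assumes "simplex_adj \<Gamma> k \<sigma> \<tau>"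
  obtains u v where "u \<in> \<sigma>" and "v \<in> V - \<sigma>" and "\<tau> = insert v (\<sigma> - {u})"
    and "insert v \<sigma> \<notin> \<Gamma>"
proof -
  have simplices: "\<sigma> \<in> simplices \<Gamma> k" "\<tau> \<in> simplices \<Gamma> k"
    using assms by (simp_all add: simplex_adj_def)
  have facets: "\<sigma> \<inter> \<tau> \<in> facets \<sigma>" "\<sigma> \<inter> \<tau> \<in> facets \<tau>" and union: "\<sigma> \<union> \<tau> \<notin> \<Gamma>"
    using assms by (simp_all add: simplex_adj_iff_facets[OF simplices])
  obtain u where u: "\<sigma> - \<tau> = {u}"
    using facets(1) by (auto simp: Int_mem_facets_iff)
  obtain v where v: "\<tau> - \<sigma> = {v}"
    using facets(2) Int_mem_facets_iff[of \<tau> \<sigma>] by (auto simp: Int_commute)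
  show thesis
  proof (rule that)
    show "u \<in> \<sigma>" and "\<tau> = insert v (\<sigma> - {u})"
      using u v by blast+
    show "v \<in> V - \<sigma>"
      using v simplicesD(3)[OF simplices(2)] by blast
    have "insert v \<sigma> = \<sigma> \<union> \<tau>"
      using v by blast
    then show "insert v \<sigma> \<notin> \<Gamma>"
      using union by simp
  qed
qed

lemma simplex_degree_le:
  assumes "\<sigma> \<in> simplices \<Gamma> k"
  shows "simplex_degree \<Gamma> k \<sigma> \<le> card (V - \<sigma>) * (k + 1)"
proof -
  have "{\<tau> \<in> simplices \<Gamma> k. simplex_adj \<Gamma> k \<sigma> \<tau>} \<subseteq>
      (\<lambda>(v, u). insert v (\<sigma> - {u})) ` ((V - \<sigma>) \<times> \<sigma>)"
    by (auto elim!: simplex_adj_exchange)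
  then have "simplex_degree \<Gamma> k \<sigma> \<le> card ((V - \<sigma>) \<times> \<sigma>)"
    unfolding simplex_degree_def using finite_vertices simplicesD(1)[OF assms]
    by (intro surj_card_le finite_cartesian_product) auto
  then show ?thesis
    using simplicesD(2)[OF assms] by (simp add: card_cartesian_product)
qed

lemma clique_complex_unique_nonneighbour:
  assumes "\<sigma> \<in> clique_complex W E" and "insert v (\<sigma> - {u}) \<in> clique_complex W E"
    and "insert v \<sigma> \<notin> clique_complex W E" and "u \<in> \<sigma>" and "v \<notin> \<sigma>"
  shows "{w \<in> \<sigma>. {w, v} \<notin> E} = {u}"
proof -
  have joined: "{w, v} \<in> E" if "w \<in> \<sigma>" and "w \<noteq> u" for w
    using assms(2,5) that by (auto simp: clique_complex_def clique_def)
  have "{u, v} \<notin> E"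
  proof
    assume "{u, v} \<in> E"
    then have "{w, v} \<in> E" if "w \<in> \<sigma>" for w
      using joined that by blast
    then have "insert v \<sigma> \<in> clique_complex W E"
      using assms(1,2) by (auto simp: clique_complex_def clique_def insert_commute)
    then show False
      using assms(3) by contradiction
  qed
  then show ?thesis
    using joined assms(4) by auto
qed

lemma simplex_degree_clique_complex_le:
  assumes "\<Gamma> = clique_complex W E" and "\<sigma> \<in> simplices \<Gamma> k"
  shows "simplex_degree \<Gamma> k \<sigma> \<le> card (V - \<sigma>)"
proof -
  have "{\<tau> \<in> simplices \<Gamma> k. simplex_adj \<Gamma> k \<sigma> \<tau>} \<subseteq>
      (\<lambda>v. insert v (\<sigma> - {w \<in> \<sigma>. {w, v} \<notin> E})) ` (V - \<sigma>)"
  proof safe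
    fix \<tau> assume "\<tau> \<in> simplices \<Gamma> k" and "simplex_adj \<Gamma> k \<sigma> \<tau>"
    moreover from this(2) obtain u v where "u \<in> \<sigma>" and v: "v \<in> V - \<sigma>"
      and \<tau>: "\<tau> = insert v (\<sigma> - {u})" and "insert v \<sigma> \<notin> \<Gamma>"
      by (rule simplex_adj_exchange)
    ultimately have "{w \<in> \<sigma>. {w, v} \<notin> E} = {u}"
      using assms simplicesD(4) by (intro clique_complex_unique_nonneighbour[of _ W]) auto
    with v \<tau> show "\<tau> \<in> (\<lambda>v. insert v (\<sigma> - {w \<in> \<sigma>. {w, v} \<notin> E})) ` (V - \<sigma>)"
      by auto
  qed
  then show ?thesis
    unfolding simplex_degree_def using finite_vertices by (intro surj_card_le) auto
qed

lemma max_simplex_degree_attained: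
  assumes "simplices \<Gamma> k \<noteq> {}"
  obtains \<sigma> where "\<sigma> \<in> simplices \<Gamma> k" and "max_simplex_degree \<Gamma> k = simplex_degree \<Gamma> k \<sigma>"
proof -
  have "max_simplex_degree \<Gamma> k \<in> simplex_degree \<Gamma> k ` simplices \<Gamma> k"
    unfolding max_simplex_degree_def using assms finite_simplices by (intro Max_in) auto
  then show thesis
    by (auto intro: that)
qed

end

theorem theorem4:
  fixes V :: "'a::linorder set" and \<Gamma> :: "'a set set" and n k :: nat
  assumes "simplicial_complex V \<Gamma>" and "card V = n" and "k \<ge> 1"
  shows
    "(\<forall>\<sigma>\<in>simplices \<Gamma> k.
        H_col_norm n \<Gamma> k \<sigma> =
          1 + 1 / real n *
            (real (simplex_degree \<Gamma> k \<sigma>) - real (up_degree \<Gamma> k \<sigma>) - real k - 1))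
     \<and>
     (\<forall>\<sigma>\<in>simplices \<Gamma> k. \<forall>\<tau>\<in>simplices \<Gamma> k.
        transition_prob n \<Gamma> k \<sigma> \<tau> =
          (if simplex_adj \<Gamma> k \<sigma> \<tau> then
             1 / (real n + real (simplex_degree \<Gamma> k \<sigma>) - real (up_degree \<Gamma> k \<sigma>) - real k - 1)
           else if \<sigma> = \<tau> then
             (real n - real (up_degree \<Gamma> k \<sigma>) - real k - 1) /
             (real n + real (simplex_degree \<Gamma> k \<sigma>) - real (up_degree \<Gamma> k \<sigma>) - real k - 1)
           else 0))
     \<and>
     (simplices \<Gamma> k \<noteq> {} \<longrightarrow>
        int (max_simplex_degree \<Gamma> k) \<le> (int n - int k - 1) * (int k + 1) \<and>
        ((\<exists>W E. simple_graph W E \<and> \<Gamma> = clique_complex W E) \<longrightarrow>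
           int (max_simplex_degree \<Gamma> k) \<le> int n - int k - 1))"
proof -
  interpret finite_simplicial_complex V \<Gamma>
    by unfold_locales (fact assms(1))
  have up_degree: "up_degree \<Gamma> k \<sigma> + k + 1 \<le> n" if "\<sigma> \<in> simplices \<Gamma> k" for \<sigma>
    using up_degree_le_card_vertices[OF that] assms(2) by simp
  show ?thesis
  proof (intro conjI ballI impI)
    fix \<sigma> assume \<sigma>: "\<sigma> \<in> simplices \<Gamma> k"
    show "H_col_norm n \<Gamma> k \<sigma> = 1 + 1 / real n *
        (real (simplex_degree \<Gamma> k \<sigma>) - real (up_degree \<Gamma> k \<sigma>) - real k - 1)"
      using up_degree[OF \<sigma>] by (simp add: H_col_norm_eq[OF \<sigma> assms(3) up_degree[OF \<sigma>]] field_simps)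
  next
    assume "simplices \<Gamma> k \<noteq> {}"
    then obtain \<sigma> where \<sigma>: "\<sigma> \<in> simplices \<Gamma> k"
      and max: "max_simplex_degree \<Gamma> k = simplex_degree \<Gamma> k \<sigma>"
      by (rule max_simplex_degree_attained)
    have outside: "int n - int k - 1 = int (card (V - \<sigma>))"
      using card_vertices_Diff[OF \<sigma>] assms(2) by simp
    show "int (max_simplex_degree \<Gamma> k) \<le> (int n - int k - 1) * (int k + 1)"
      unfolding outside max
      using zle_int[THEN iffD2, OF simplex_degree_le[OF \<sigma>]] by (simp add: algebra_simps)
    assume "\<exists>W E. simple_graph W E \<and> \<Gamma> = clique_complex W E"
    then show "int (max_simplex_degree \<Gamma> k) \<le> int n - int k - 1"
      using simplex_degree_clique_complex_le[OF _ \<sigma>] by (auto simp: outside max)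
  qed (rule transition_prob_eq[OF _ _ assms(3) up_degree])
qed

end
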